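(* Let $p,q,z$ be positive integers with $2<p<q$ and $q=2^z$, let $n=pq$, let $t=\log_n p$ and $k=p=n^t$. Let $V=\{1,\dots,n\}=\mathcal{V}_1\cup\mathcal{V}_2$ with $\mathcal{V}_1=\{1,\dots,n-q\}$ and $\mathcal{V}_2=\{n-q+1,\dots,n\}$. For $0\le r\le q-1$ let $V_r=\{i\in V:(i-1)\bmod q=r\}$. Let $E_1$ be the set of all $k$-subsets of $\mathcal{V}_1$; let $E_2$ be the set of all $k$-subsets of $V$ consisting of $k-1$ vertices of $\mathcal{V}_1$ and one vertex of $\mathcal{V}_2$; let $E_3$ be the set of all $k$-subsets of $V$ contained in some $V_r$. Let $G(V,E)$ be the $k$-uniform hypergraph with $E=(E_1\cup E_2)\setminus E_3$. Then (i) $\chi^c(G)=\lceil\log_2 n^{1-t}\rceil$, (ii) $\alpha(G)=n^{1-t}+n^t-2$, and (iii) $\gamma(G)=n^t$.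
   Context: A set $I\subseteq V$ is independent if it contains no hyperedge; $\alpha(G)$ is the maximum size of an independent set. A bicoloring of $G$ is a map $X:V\to\{0,1\}$; a bicoloring cover of $G$ is a set of bicolorings such that every hyperedge is non-monochromatic under at least one of them; $\chi^c(G)$ is the minimum size of a bicoloring cover. For an optimal bicoloring cover $C=\{X_1,\dots,X_{\chi^c(G)}\}$, each vertex $v$ gets the color bit vector $(X_1(v),\dots,X_{\chi^c(G)}(v))$, and $\gamma_C(G)$ is the maximum number of vertices sharing a common bit vector. The cover independence number $\gamma(G)$ is the maximum of $\gamma_C(G)$ over all bicoloring covers $C$ of size $\chi^c(G)$. *)

theory Defs
  imports Complex_Main "HOL-Library.FuncSet"
begin

text \<open>A hypergraph is given by its vertex set V and its set E of hyperedges.\<close>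

definition independent :: "'a set \<Rightarrow> 'a set set \<Rightarrow> 'a set \<Rightarrow> bool" where
  "independent V E I \<longleftrightarrow> I \<subseteq> V \<and> \<not> (\<exists>e\<in>E. e \<subseteq> I)"

definition independence_number :: "'a set \<Rightarrow> 'a set set \<Rightarrow> nat" where
  "independence_number V E = Max {card I | I. independent V E I}"

text \<open>Bicolorings are extensional functions, so that maps from V to {0,1} are counted
  without regard to values outside V.\<close>

definition bicolorings :: "'a set \<Rightarrow> ('a \<Rightarrow> nat) set" where
  "bicolorings V = V \<rightarrow>\<^sub>E {0, 1}"

definition monochromatic :: "('a \<Rightarrow> nat) \<Rightarrow> 'a set \<Rightarrow> bool" where
  "monochromatic X e \<longleftrightarrow> (\<forall>u\<in>e. \<forall>v\<in>e. X u = X v)"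

definition bicoloring_cover :: "'a set \<Rightarrow> 'a set set \<Rightarrow> ('a \<Rightarrow> nat) set \<Rightarrow> bool" where
  "bicoloring_cover V E C \<longleftrightarrow>
     finite C \<and> C \<subseteq> bicolorings V \<and> (\<forall>e\<in>E. \<exists>X\<in>C. \<not> monochromatic X e)"

definition bicoloring_cover_number :: "'a set \<Rightarrow> 'a set set \<Rightarrow> nat" where
  "bicoloring_cover_number V E = (LEAST c. \<exists>C. bicoloring_cover V E C \<and> card C = c)"

definition optimal_bicoloring_cover :: "'a set \<Rightarrow> 'a set set \<Rightarrow> ('a \<Rightarrow> nat) set \<Rightarrow> bool" where
  "optimal_bicoloring_cover V E C \<longleftrightarrow>
     bicoloring_cover V E C \<and> card C = bicoloring_cover_number V E"

text \<open>The color bit vector of v is indexed by the bicolorings in C themselves; which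
  vertices share a bit vector does not depend on an enumeration of C.\<close>

definition bit_vector :: "('a \<Rightarrow> nat) set \<Rightarrow> 'a \<Rightarrow> (('a \<Rightarrow> nat) \<Rightarrow> nat)" where
  "bit_vector C v = (\<lambda>X\<in>C. X v)"

definition max_common_bit_vector :: "'a set \<Rightarrow> ('a \<Rightarrow> nat) set \<Rightarrow> nat" where
  "max_common_bit_vector V C =
     Max {card {v \<in> V. bit_vector C v = b} | b. b \<in> C \<rightarrow>\<^sub>E {0, 1}}"

definition cover_independence_number :: "'a set \<Rightarrow> 'a set set \<Rightarrow> nat" where
  "cover_independence_number V E =
     Max {max_common_bit_vector V C | C. optimal_bicoloring_cover V E C}"

end

theory Submission
  imports Defs
begin

text \<open>
  An independent set meets \<open>V1\<close> in at most \<open>k - 1\<close> vertices, and if it meets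
  \<open>V1\<close> in exactly \<open>k - 1\<close> vertices then it has at most one vertex of \<open>V2\<close>, because only one
  extension of those \<open>k - 1\<close> vertices can be a residue class. The vertices sharing a bit vector of a
  cover \<open>C\<close> form an independent set, and there are \<open>2 ^ card C\<close> bit vectors for the
  \<open>(k - 1) * 2 ^ z\<close> vertices of \<open>V1\<close>; hence \<open>card C \<ge> z\<close>. If \<open>card C = z\<close>, equality
  holds throughout, so every class has \<open>k - 1\<close> vertices in \<open>V1\<close> and one in \<open>V2\<close>.
  The binary digits of the residues give a cover of size \<open>z\<close>.
\<close>

section \<open>Color classes of a bicoloring cover\<close>

definition color_class :: "'a set \<Rightarrow> ('a \<Rightarrow> nat) set \<Rightarrow> (('a \<Rightarrow> nat) \<Rightarrow> nat) \<Rightarrow> 'a set" where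
  "color_class V C b = {v \<in> V. bit_vector C v = b}"

text \<open>On a class every \<open>X\<close> in \<open>C\<close> is constant with value
  \<open>b X\<close>, so an edge inside it would be split by no member of the cover.\<close>

lemma independent_color_class:
  assumes "bicoloring_cover V E C"
  shows "independent V E (color_class V C b)"
  unfolding independent_def
proof (intro conjI notI)
  show "color_class V C b \<subseteq> V" by (auto simp: color_class_def)
  assume "\<exists>e\<in>E. e \<subseteq> color_class V C b"
  then obtain e where e: "e \<in> E" "e \<subseteq> color_class V C b" by blast
  obtain X where X: "X \<in> C" "\<not> monochromatic X e"
    using assms e(1) by (auto simp: bicoloring_cover_def)
  have "X v = b X" if "v \<in> e" for v
  proof -
    have "bit_vector C v = b" using e(2) that by (auto simp: color_class_def)
    then show ?thesis using X(1) by (auto simp: bit_vector_def)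
  qed
  then show False using X(2) by (auto simp: monochromatic_def)
qed

lemma bit_vector_in:
  assumes "bicoloring_cover V E C" "v \<in> V"
  shows "bit_vector C v \<in> C \<rightarrow>\<^sub>E {0, 1}"
  using assms by (auto simp: bit_vector_def bicoloring_cover_def bicolorings_def PiE_iff)

lemma card_bit_vectors:
  assumes "finite C"
  shows "card (C \<rightarrow>\<^sub>E {0, Suc 0}) = 2 ^ card C"
  using assms by (simp add: card_PiE numeral_2_eq_2)

text \<open>The classes partition \<open>V\<close>; bit vectors that do not occur contribute 0. The
  subset \<open>W\<close> allows counting in \<open>V1\<close> and in \<open>V2\<close>
  separately.\<close>

lemma sum_card_color_class:
  assumes "bicoloring_cover V E C" "finite V" "W \<subseteq> V"
  shows "(\<Sum>b\<in>C \<rightarrow>\<^sub>E {0, 1}. card (color_class V C b \<inter> W)) = card W"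
proof -
  have fin: "finite (C \<rightarrow>\<^sub>E {0, 1::nat})"
    using assms(1) by (auto simp: bicoloring_cover_def intro!: finite_PiE)
  have "W = (\<Union>b\<in>C \<rightarrow>\<^sub>E {0, 1}. color_class V C b \<inter> W)"
    using bit_vector_in[OF assms(1)] assms(3) by (auto simp: color_class_def)
  also have "card \<dots> = (\<Sum>b\<in>C \<rightarrow>\<^sub>E {0, 1}. card (color_class V C b \<inter> W))"
    using fin finite_subset[OF assms(3,2)]
    by (intro card_UN_disjoint) (auto simp: color_class_def)
  finally show ?thesis by simp
qed

text \<open>Bicoloring \<open>X j\<close> reads binary digit \<open>j\<close> of \<open>f\<close>;
  different residues modulo \<open>2 ^ z\<close> differ in some digit below \<open>z\<close>. The
  size is only bounded above, because several \<open>X j\<close> may coincide on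
  \<open>V\<close>.\<close>

lemma binary_digit_cover:
  fixes f :: "'a \<Rightarrow> nat"
  assumes "\<And>e. e \<in> E \<Longrightarrow> e \<subseteq> V"
    and sep: "\<And>e. e \<in> E \<Longrightarrow> \<exists>u\<in>e. \<exists>v\<in>e. f u mod 2 ^ z \<noteq> f v mod 2 ^ z"
  shows "\<exists>C. bicoloring_cover V E C \<and> card C \<le> z"
proof -
  define X where "X j = (\<lambda>v\<in>V. of_bool (bit (f v) j) :: nat)" for j
  have "\<exists>Y\<in>X ` {..<z}. \<not> monochromatic Y e" if e: "e \<in> E" for e
  proof -
    obtain u v where uv: "u \<in> e" "v \<in> e" "take_bit z (f u) \<noteq> take_bit z (f v)"
      using sep[OF e] by (auto simp: take_bit_eq_mod)
    then obtain j where "j < z" "bit (f u) j \<noteq> bit (f v) j"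
      by (auto simp: bit_eq_iff bit_take_bit_iff)
    then have "X j u \<noteq> X j v"
      using uv assms(1)[OF e] by (auto simp: X_def)
    then show ?thesis using uv \<open>j < z\<close> by (auto simp: monochromatic_def)
  qed
  then have "bicoloring_cover V E (X ` {..<z})"
    by (auto simp: bicoloring_cover_def bicolorings_def X_def)
  moreover have "card (X ` {..<z}) \<le> z"
    using card_image_le[of "{..<z}" X] by simp
  ultimately show ?thesis by blast
qed

text \<open>Isolates what the counting uses, so that residues no longer appear:
  \<open>edge_insert\<close> records that \<open>E3\<close> removes at most one extension of a given
  \<open>A\<close>, and \<open>edge_inter\<close> serves the lower bound on the independence
  number.\<close>

locale two_part_hypergraph =
  fixes V V1 V2 :: "'a set" and E :: "'a set set" and k z :: nat
  assumes V_eq: "V = V1 \<union> V2" and disj: "V1 \<inter> V2 = {}"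
    and fin: "finite V1" "finite V2"
    and card_V1: "card V1 = (k - 1) * 2 ^ z" and card_V2: "card V2 = 2 ^ z"
    and k_ge: "2 \<le> k" and z_pos: "0 < z"
    and edge_V1: "\<And>e. e \<subseteq> V1 \<Longrightarrow> card e = k \<Longrightarrow> e \<in> E"
    and edge_insert: "\<And>A u v. A \<subseteq> V1 \<Longrightarrow> card A = k - 1 \<Longrightarrow> u \<in> V2 \<Longrightarrow> v \<in> V2 \<Longrightarrow> u \<noteq> v \<Longrightarrow>
      insert u A \<in> E \<or> insert v A \<in> E"
    and edge_inter: "\<And>e. e \<in> E \<Longrightarrow> k - 1 \<le> card (e \<inter> V1)"
    and small_cover: "\<exists>C. bicoloring_cover V E C \<and> card C \<le> z"
begin

section \<open>Independent sets\<close>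

lemma finite_V: "finite V"
  using fin by (simp add: V_eq)

lemma independent_inter_V1:
  assumes "independent V E I"
  shows "card (I \<inter> V1) \<le> k - 1"
proof (rule ccontr)
  assume "\<not> ?thesis"
  then have "k \<le> card (I \<inter> V1)" by simp
  then obtain e where "e \<subseteq> I \<inter> V1" "card e = k"
    by (meson obtain_subset_with_card_n)
  then show False using edge_V1[of e] assms by (auto simp: independent_def)
qed

lemma independent_inter_V2:
  assumes I: "independent V E I" and c: "card (I \<inter> V1) = k - 1"
  shows "card (I \<inter> V2) \<le> 1"
proof (rule ccontr)
  assume "\<not> ?thesis"
  then obtain u v where "u \<in> I \<inter> V2" "v \<in> I \<inter> V2" "u \<noteq> v"
    using fin by (auto simp: card_le_Suc0_iff_eq)
  then show False using edge_insert[of "I \<inter> V1" u v] c I by (auto simp: independent_def)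
qed

lemma card_split:
  assumes "I \<subseteq> V"
  shows "card I = card (I \<inter> V1) + card (I \<inter> V2)"
proof -
  have "I = (I \<inter> V1) \<union> (I \<inter> V2)" using assms V_eq by auto
  then show ?thesis using disj fin
    by (metis card_Un_disjoint finite_Int inf_assoc inf_bot_right inf_left_commute)
qed

lemma independence_number: "independence_number V E = 2 ^ z + k - 2"
  unfolding independence_number_def
proof (rule Max_eqI)
  have "{card I |I. independent V E I} \<subseteq> card ` Pow V" by (auto simp: independent_def)
  then show "finite {card I |I. independent V E I}"
    using finite_V by (meson finite_Pow_iff finite_imageI finite_subset)
next
  fix y assume "y \<in> {card I |I. independent V E I}"
  then obtain I where I: "y = card I" "independent V E I" by blast
  have y: "y = card (I \<inter> V1) + card (I \<inter> V2)"
    using card_split I by (auto simp: independent_def)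
  have le: "card (I \<inter> V2) \<le> 2 ^ z"
    using card_V2 fin by (metis card_mono inf_le2)
  \<comment> \<open>\<open>2 ^ z \<ge> 2\<close> settles the case of \<open>k - 1\<close> vertices
    in \<open>V1\<close>, where the total is at most \<open>k\<close>; otherwise there are at most
    \<open>k - 2\<close> of them plus all of \<open>V2\<close>.\<close>
  have "(2::nat) ^ 1 \<le> 2 ^ z" using z_pos by (intro power_increasing) auto
  moreover note independent_inter_V1[OF I(2)] independent_inter_V2[OF I(2)]
  ultimately show "y \<le> 2 ^ z + k - 2"
    using y le k_ge by (cases "card (I \<inter> V1) = k - 1") auto
next
  \<comment> \<open>Extremal set: all of \<open>V2\<close> with \<open>k - 2\<close> vertices of
    \<open>V1\<close>, one fewer than \<open>edge_inter\<close> demands of an edge.\<close>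
  have "k - 2 \<le> card V1" using card_V1
    by (metis diff_le_mono2 le_trans mult_le_mono2 nat_mult_1_right one_le_numeral
        one_le_power order_refl)
  then obtain A where A: "A \<subseteq> V1" "card A = k - 2"
    by (meson obtain_subset_with_card_n)
  have inter: "(A \<union> V2) \<inter> V1 = A" using A disj by auto
  have "\<not> e \<subseteq> A \<union> V2" if "e \<in> E" for e
  proof
    assume "e \<subseteq> A \<union> V2"
    then have "e \<inter> V1 \<subseteq> A" using disj by auto
    then have "card (e \<inter> V1) \<le> k - 2"
      using A fin by (metis card_mono finite_subset)
    then show False using edge_inter[OF that] k_ge by simp
  qed
  then have "independent V E (A \<union> V2)"
    using A V_eq by (auto simp: independent_def)
  moreover have "card (A \<union> V2) = 2 ^ z + k - 2"
    using A disj fin card_V2 k_ge by (subst card_Un_disjoint) (auto dest: finite_subset)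
  ultimately show "2 ^ z + k - 2 \<in> {card I |I. independent V E I}" by (metis (mono_tags) CollectI)
qed

section \<open>Minimum covers and their color classes\<close>

lemma cover_card_ge:
  assumes C: "bicoloring_cover V E C"
  shows "z \<le> card C"
proof -
  have "finite C" using C by (simp add: bicoloring_cover_def)
  have "(k - 1) * 2 ^ z = (\<Sum>b\<in>C \<rightarrow>\<^sub>E {0, 1}. card (color_class V C b \<inter> V1))"
    using sum_card_color_class[OF C finite_V, of V1] card_V1 V_eq by simp
  also have "\<dots> \<le> card (C \<rightarrow>\<^sub>E {0, 1::nat}) * (k - 1)"
    using sum_bounded_above[of "C \<rightarrow>\<^sub>E {0, 1}" "\<lambda>b. card (color_class V C b \<inter> V1)" "k - 1"]
      independent_inter_V1[OF independent_color_class[OF C]] by simp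
  finally have "(2::nat) ^ z \<le> 2 ^ card C"
    using k_ge \<open>finite C\<close> by (simp add: card_bit_vectors mult.commute)
  then show ?thesis by simp
qed

lemma bicoloring_cover_number: "bicoloring_cover_number V E = z"
  unfolding bicoloring_cover_number_def
proof (rule Least_equality)
  show "\<exists>C. bicoloring_cover V E C \<and> card C = z"
    using small_cover cover_card_ge by (metis le_antisym)
qed (use cover_card_ge in auto)

lemma card_color_class:
  assumes C: "bicoloring_cover V E C" "card C = z" and b: "b \<in> C \<rightarrow>\<^sub>E {0, 1}"
  shows "card (color_class V C b) = k"
proof -
  let ?B = "C \<rightarrow>\<^sub>E {0, 1::nat}"
  have "finite C" using C by (simp add: bicoloring_cover_def)
  then have B: "card ?B = 2 ^ z" "finite ?B"
    using C(2) by (auto simp: card_bit_vectors intro!: finite_PiE)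
  note ind = independent_color_class[OF C(1)]
  have "(\<Sum>b\<in>?B. card (color_class V C b \<inter> V1)) = (\<Sum>b\<in>?B. k - 1)"
    using sum_card_color_class[OF C(1) finite_V, of V1] card_V1 B V_eq by simp
  \<comment> \<open>Each summand is at most \<open>k - 1\<close> and the total is the largest
    possible, so every summand equals \<open>k - 1\<close>.\<close>
  then have V1: "card (color_class V C b \<inter> V1) = k - 1" if "b \<in> ?B" for b
    using independent_inter_V1[OF ind] that B(2) by (rule sum_mono_inv)
  have "(\<Sum>b\<in>?B. card (color_class V C b \<inter> V2)) = (\<Sum>b\<in>?B. 1)"
    using sum_card_color_class[OF C(1) finite_V, of V2] card_V2 B V_eq by simp
  \<comment> \<open>The bound 1 in \<open>V2\<close> is available only for classes with
    \<open>k - 1\<close> vertices in \<open>V1\<close>, hence the order of the two counts.\<close>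
  then have V2: "card (color_class V C b \<inter> V2) = 1" if "b \<in> ?B" for b
    using independent_inter_V2[OF ind V1] that B(2) by (rule sum_mono_inv)
  show ?thesis
    using card_split[of "color_class V C b"] V1[OF b] V2[OF b] k_ge
    by (auto simp: color_class_def)
qed

lemma max_common_bit_vector:
  assumes C: "bicoloring_cover V E C" "card C = z"
  shows "max_common_bit_vector V C = k"
proof -
  \<comment> \<open>Some bit vector must exist for the set of class sizes to be \<open>{k}\<close>
    and not empty.\<close>
  have "C \<rightarrow>\<^sub>E {0, 1::nat} \<noteq> {}" by (simp add: PiE_eq_empty_iff)
  then obtain b0 where b0: "b0 \<in> C \<rightarrow>\<^sub>E {0, 1::nat}" by blast
  note card = card_color_class[OF C, unfolded color_class_def]
  have "{card {v \<in> V. bit_vector C v = b} |b. b \<in> C \<rightarrow>\<^sub>E {0, 1}} = {k}"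
    using card b0 card[OF b0] by blast
  then show ?thesis by (simp only: max_common_bit_vector_def Max_singleton)
qed

text \<open>All optimal covers give the same value, so the maximum over them only requires that one
  exists.\<close>

lemma cover_independence_number: "cover_independence_number V E = k"
proof -
  have "optimal_bicoloring_cover V E C \<longleftrightarrow> bicoloring_cover V E C \<and> card C = z" for C
    by (simp add: optimal_bicoloring_cover_def bicoloring_cover_number)
  moreover have "\<exists>C. bicoloring_cover V E C \<and> card C = z"
    using small_cover cover_card_ge by (metis le_antisym)
  ultimately obtain C0 where C0: "optimal_bicoloring_cover V E C0"
    and opt: "\<And>C. optimal_bicoloring_cover V E C \<Longrightarrow> max_common_bit_vector V C = k"
    using max_common_bit_vector by blast
  have "{max_common_bit_vector V C |C. optimal_bicoloring_cover V E C} = {k}"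
    using C0 opt opt[OF C0] by blast
  then show ?thesis by (simp only: cover_independence_number_def Max_singleton)
qed

end

section \<open>The concrete hypergraph\<close>

theorem theorem9:
  fixes p q z n k :: nat and t :: real
    and V V1 V2 :: "nat set" and Vr :: "nat \<Rightarrow> nat set"
    and E1 E2 E3 E :: "nat set set"
  assumes "0 < p" and "0 < q" and "0 < z"
    and "2 < p" and "p < q" and "q = 2 ^ z"
    and "n = p * q"
    and "t = log (real n) (real p)"
    and "k = p"
    and "V = {1..n}"
    and "V1 = {1..n - q}"
    and "V2 = {n - q + 1..n}"
    and "\<And>r. r \<le> q - 1 \<Longrightarrow> Vr r = {i \<in> V. (i - 1) mod q = r}"
    and "E1 = {e. e \<subseteq> V1 \<and> card e = k}"
    and "E2 = {e. e \<subseteq> V \<and> card e = k \<and> card (e \<inter> V1) = k - 1 \<and> card (e \<inter> V2) = 1}"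
    and "E3 = {e. e \<subseteq> V \<and> card e = k \<and> (\<exists>r\<le>q - 1. e \<subseteq> Vr r)}"
    and "E = (E1 \<union> E2) - E3"
  shows "int (bicoloring_cover_number V E) = \<lceil>log 2 (real n powr (1 - t))\<rceil>
    \<and> real (independence_number V E) = real n powr (1 - t) + real n powr t - 2
    \<and> real (cover_independence_number V E) = real n powr t"
proof -
  have k: "k = p" and q_pos: "0 < q" and p2: "2 < p" and n: "n = p * q" by fact+
  have n1: "n - q = (p - 1) * q" by (simp add: n diff_mult_distrib)
  have qn: "q \<le> n" using p2 by (simp add: n)
  have V: "V = V1 \<union> V2" using assms(10-12) qn by auto
  have V12: "V1 \<inter> V2 = {}" using assms(11,12) by auto
  have fin: "finite V1" "finite V2" using assms(11,12) by auto
  have same: "e \<subseteq> Vr r \<longleftrightarrow> e \<subseteq> V \<and> (\<forall>i\<in>e. (i - 1) mod q = r)" if "r \<le> q - 1" for e r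
    using assms(13)[OF that] by auto
  \<comment> \<open>\<open>V2\<close> is a block of \<open>q\<close> consecutive integers, so it
    meets each residue class once; this limits the extensions lost to \<open>E3\<close>.\<close>
  have V2_inj: "inj_on (\<lambda>i. (i - 1) mod q) V2"
  proof (rule inj_onI)
    have aux: "u = v" if "u \<in> V2" "v \<in> V2" "(u - 1) mod q = (v - 1) mod q" "u \<le> v" for u v
    proof -
      have "q dvd (v - 1) - (u - 1)"
        using that by (metis diff_le_mono mod_eq_dvd_iff_nat)
      moreover have "(v - 1) - (u - 1) < q" using that assms(12) qn q_pos by auto
      ultimately have "(v - 1) - (u - 1) = 0" using dvd_imp_le by fastforce
      then show ?thesis using that assms(12) by auto
    qed
    fix u v assume "u \<in> V2" "v \<in> V2" "(u - 1) mod q = (v - 1) mod q"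
    then show "u = v" using aux[of u v] aux[of v u] by (cases "u \<le> v") auto
  qed
  \<comment> \<open>\<open>V1\<close> consists of \<open>p - 1\<close> blocks of length
    \<open>q\<close>, and the block index \<open>(i - 1) div q\<close> determines \<open>i\<close>
    within a residue class. As \<open>k = p\<close>, no \<open>k\<close>-subset of \<open>V1\<close>
    lies in \<open>E3\<close>.\<close>
  have class_V1: "card {i \<in> V1. (i - 1) mod q = r} < p" for r
  proof -
    have "inj_on (\<lambda>i. (i - 1) div q) {i \<in> V1. (i - 1) mod q = r}"
    proof (rule inj_onI)
      fix x y assume a: "x \<in> {i \<in> V1. (i - 1) mod q = r}" "y \<in> {i \<in> V1. (i - 1) mod q = r}"
        "(x - 1) div q = (y - 1) div q"
      then have "x - 1 = y - 1" by (metis (mono_tags, lifting) div_mult_mod_eq mem_Collect_eq)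
      then show "x = y" using a assms(11) by auto
    qed
    moreover have "(\<lambda>i. (i - 1) div q) ` {i \<in> V1. (i - 1) mod q = r} \<subseteq> {..<p - 1}"
    proof (clarsimp simp: assms(11))
      fix i :: nat assume "Suc 0 \<le> i" "i \<le> n - q"
      then have "i - 1 < (p - 1) * q" by (simp add: n1)
      then show "(i - Suc 0) div q < p - Suc 0" by (simp add: less_mult_imp_div_less)
    qed
    ultimately have "card {i \<in> V1. (i - 1) mod q = r} \<le> p - 1"
      using card_inj_on_le[of _ _ "{..<p - 1}"] by fastforce
    then show ?thesis using p2 by simp
  qed
  have E_sub: "e \<subseteq> V" if "e \<in> E" for e
    using that assms(14,15,17) V by auto
  \<comment> \<open>An edge with a single residue would belong to \<open>E3\<close>; this is the
    separation that the binary digit cover requires.\<close>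
  have sep: "\<exists>u\<in>e. \<exists>v\<in>e. (u - 1) mod q \<noteq> (v - 1) mod q" if "e \<in> E" for e
  proof (rule ccontr)
    assume "\<not> ?thesis"
    then have eq: "\<And>u v. u \<in> e \<Longrightarrow> v \<in> e \<Longrightarrow> (u - 1) mod q = (v - 1) mod q" by blast
    have card: "card e = k" using that assms(14,15,17) by auto
    then obtain u where u: "u \<in> e" using p2 k by fastforce
    have r: "(u - 1) mod q \<le> q - 1"
      using q_pos by (metis Suc_pred' less_Suc_eq_le mod_less_divisor)
    then have "e \<subseteq> Vr ((u - 1) mod q)"
      using same[OF r] E_sub[OF that] eq u by blast
    then have "e \<in> E3"
      using E_sub[OF that] card r by (auto simp: assms(16))
    then show False using that assms(17) by blast
  qed
  interpret two_part_hypergraph V V1 V2 E k z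
  proof
    show "card V1 = (k - 1) * 2 ^ z" "card V2 = 2 ^ z"
      using assms(6,11,12) n1 k qn by simp_all
    \<comment> \<open>The shift \<open>i - 1\<close> matches \<open>Vr\<close>, and
      \<open>q = 2 ^ z\<close> makes the residues \<open>z\<close>-digit binary numbers.\<close>
    show "\<exists>C. bicoloring_cover V E C \<and> card C \<le> z"
      using binary_digit_cover[of E V "\<lambda>i. i - 1" z] E_sub sep assms(6) by blast
  next
    fix e assume e: "e \<subseteq> V1" "card e = k"
    have "\<not> e \<subseteq> Vr r" if "r \<le> q - 1" for r
    proof
      assume "e \<subseteq> Vr r"
      then have "e \<subseteq> {i \<in> V1. (i - 1) mod q = r}" using same[OF that] e by auto
      then have "card e \<le> card {i \<in> V1. (i - 1) mod q = r}"
        using fin by (intro card_mono) auto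
      then show False using class_V1[of r] e k by simp
    qed
    then show "e \<in> E" using e by (auto simp: assms(14,16,17))
  next
    fix A u v assume A: "A \<subseteq> V1" "card A = k - 1" and uv: "u \<in> V2" "v \<in> V2" "u \<noteq> v"
    have E2: "insert w A \<in> E2" if "w \<in> V2" for w
    proof -
      have "w \<notin> A" "finite A" using that A V12 fin by (auto dest: finite_subset)
      moreover have "insert w A \<inter> V1 = A" "insert w A \<inter> V2 = {w}" using that A V12 by auto
      ultimately show ?thesis using that A V p2 k by (auto simp: assms(15))
    qed
    \<comment> \<open>\<open>k > 2\<close> makes \<open>A\<close> nonempty, and \<open>a\<close>
      fixes the only residue that an extension in \<open>E3\<close> can have.\<close>
    obtain a where a: "a \<in> A" using A p2 k by fastforce
    have res: "(w - 1) mod q = (a - 1) mod q" if w: "insert w A \<in> E3" for w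
    proof -
      obtain r where "r \<le> q - 1" "insert w A \<subseteq> Vr r"
        using w by (auto simp: assms(16))
      then show ?thesis using same a by (metis insertCI)
    qed
    have "insert u A \<notin> E3 \<or> insert v A \<notin> E3"
      using res[of u] res[of v] inj_onD[OF V2_inj _ uv(1,2)] uv(3) by auto
    then show "insert u A \<in> E \<or> insert v A \<in> E"
      using E2 uv by (auto simp: assms(17))
  next
    fix e assume "e \<in> E"
    then show "k - 1 \<le> card (e \<inter> V1)"
      by (auto simp: assms(14,15,17) Int_absorb2)
  qed (use V V12 fin p2 k assms(3) in auto)
  \<comment> \<open>\<open>n > 1\<close> makes the power with base \<open>n\<close> invert
    \<open>log\<close>, so \<open>n powr t = p\<close> and
    \<open>n powr (1 - t) = n / p = q\<close>.\<close>
  have "n > 1" unfolding n using p2 assms(5) by (intro less_1_mult) auto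
  then have "real n > 1" by simp
  then have powr_t: "real n powr t = real p"
    using p2 assms(8) by simp
  then have powr_1t: "real n powr (1 - t) = real q"
    using \<open>real n > 1\<close> p2 by (simp add: powr_diff n)
  \<comment> \<open>An exact integer, so the ceiling in the first claim is \<open>z\<close>.\<close>
  have "log 2 (real q) = real z" using assms(6) by (simp add: log_nat_power)
  then show ?thesis
    using bicoloring_cover_number independence_number cover_independence_number
      powr_t powr_1t p2 k assms(6) by simp
qed

end
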